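(* There exists a filter $\mathcal{F}_0$ on $\omega$ with the following properties: (a) every filter $\mathcal{F}$ on $\omega$ with $\mathcal{F}\supset\mathcal{F}_0$ is reversible; (b) $K_{\mathcal{F}_0}$ is crowded (i.e. has no isolated points in its subspace topology) and nowhere dense in $\omega^*$; and (c) if $X$ is any closed subset of $\omega^*$, there exists a filter $\mathcal{F}\supset\mathcal{F}_0$ on $\omega$ such that $K_{\mathcal{F}}$ is homeomorphic to $X$.
   Context: A filter on $\omega$ is a nonempty family of subsets of $\omega$ closed under supersets and finite intersections; all filters on $\omega$ are assumed to contain the Fréchet filter of all cofinite subsets of $\omega$. For a filter $\mathcal{F}$ on $\omega$, $\xi(\mathcal{F})$ is the topological space with underlying set $\omega\cup\{\mathcal{F}\}$ in which every point of $\omega$ is isolated and the neighborhoods of the point $\mathcal{F}$ are the sets $\{\mathcal{F}\}\cup A$ with $A\in\mathcal{F}$. A topological space is reversible if every continuous bijection of the space onto itself is a homeomorphism. A filter $\mathcal{F}$ is reversible if the space $\xi(\mathcal{F})$ is reversible. $\beta\omega$ is the Čech–Stone compactification of the discrete space $\omega$ (the Stone space of all ultrafilters on $\omega$), and $\omega^*=\beta\omega\setminus\omega$ is the subspace of free ultrafilters. For a filter $\mathcal{F}$ on $\omega$, $K_{\mathcal{F}}=\{p\in\beta\omega:\mathcal{F}\subset p\}$, a closed subset of $\omega^*$, considered with the subspace topology. *)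

theory Defs
  imports "HOL-Analysis.Analysis"
begin

text \<open>
  Filters on \<open>\<omega>\<close> are values of the library type \<^typ>\<open>nat filter\<close>; a set \<open>A\<close> belongs to
  \<open>F\<close> when \<^prop>\<open>eventually (\<lambda>n. n \<in> A) F\<close>. As families of sets they are ordered by reverse
  inclusion: \<^prop>\<open>F \<le> G\<close> says that every member of \<open>G\<close> is a member of \<open>F\<close>. The improper
  filter \<^term>\<open>bot :: nat filter\<close>, the family of all subsets of \<open>\<omega>\<close>, is allowed.
\<close>

definition omega_filter :: "nat filter \<Rightarrow> bool" where
  "omega_filter F \<longleftrightarrow> F \<le> cofinite"

text \<open>The space \<open>\<xi>(F)\<close>: \<^term>\<open>Some n\<close> is the point \<open>n\<close> of \<open>\<omega>\<close>, and \<^term>\<open>None\<close> is the point \<open>F\<close>.\<close>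

definition xi :: "nat filter \<Rightarrow> nat option topology" where
  "xi F = topology (\<lambda>U. None \<in> U \<longrightarrow> eventually (\<lambda>n. Some n \<in> U) F)"

lemma openin_xi: "openin (xi F) U \<longleftrightarrow> (None \<in> U \<longrightarrow> eventually (\<lambda>n. Some n \<in> U) F)"
proof -
  have "istopology (\<lambda>U. None \<in> U \<longrightarrow> eventually (\<lambda>n. Some n \<in> U) F)"
    unfolding istopology_def
  proof (intro conjI allI impI)
    fix S T :: "nat option set"
    assume "None \<in> S \<longrightarrow> eventually (\<lambda>n. Some n \<in> S) F"
      and "None \<in> T \<longrightarrow> eventually (\<lambda>n. Some n \<in> T) F" and "None \<in> S \<inter> T"
    then show "eventually (\<lambda>n. Some n \<in> S \<inter> T) F"
      by (simp add: eventually_conj)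
  next
    fix \<K> :: "nat option set set"
    assume K: "\<forall>K\<in>\<K>. None \<in> K \<longrightarrow> eventually (\<lambda>n. Some n \<in> K) F" and "None \<in> \<Union>\<K>"
    then obtain K where "K \<in> \<K>" "eventually (\<lambda>n. Some n \<in> K) F"
      by blast
    then show "eventually (\<lambda>n. Some n \<in> \<Union>\<K>) F"
      by (auto elim: eventually_mono)
  qed
  then show ?thesis
    by (simp add: xi_def topology_inverse')
qed

lemma topspace_xi [simp]: "topspace (xi F) = UNIV"
proof -
  have "openin (xi F) UNIV"
    by (simp add: openin_xi)
  then show ?thesis
    using openin_subset by blast
qed

lemma neighbourhoods_None_xi:
  "(\<exists>U. openin (xi F) U \<and> None \<in> U \<and> U \<subseteq> N) \<longleftrightarrow>
   (\<exists>A. eventually (\<lambda>n. n \<in> A) F \<and> N = insert None (Some ` A))"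
proof
  assume "\<exists>U. openin (xi F) U \<and> None \<in> U \<and> U \<subseteq> N"
  then obtain U where U: "eventually (\<lambda>n. Some n \<in> U) F" "None \<in> U" "U \<subseteq> N"
    by (auto simp: openin_xi)
  have "eventually (\<lambda>n. n \<in> {n. Some n \<in> N}) F"
    using U by (auto elim: eventually_mono)
  moreover have "N = insert None (Some ` {n. Some n \<in> N})"
  proof (rule set_eqI)
    fix x show "x \<in> N \<longleftrightarrow> x \<in> insert None (Some ` {n. Some n \<in> N})"
      using U by (cases x) auto
  qed
  ultimately show "\<exists>A. eventually (\<lambda>n. n \<in> A) F \<and> N = insert None (Some ` A)"
    by blast
next
  assume "\<exists>A. eventually (\<lambda>n. n \<in> A) F \<and> N = insert None (Some ` A)"
  then obtain A where "eventually (\<lambda>n. n \<in> A) F" "N = insert None (Some ` A)"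
    by blast
  then have "openin (xi F) N" "None \<in> N"
    by (auto simp: openin_xi image_iff)
  then show "\<exists>U. openin (xi F) U \<and> None \<in> U \<and> U \<subseteq> N"
    by blast
qed

definition reversible_space :: "'a topology \<Rightarrow> bool" where
  "reversible_space X \<longleftrightarrow>
     (\<forall>f. continuous_map X X f \<and> bij_betw f (topspace X) (topspace X) \<longrightarrow> homeomorphic_map X X f)"

definition reversible_filter :: "nat filter \<Rightarrow> bool" where
  "reversible_filter F \<longleftrightarrow> reversible_space (xi F)"

definition ultrafilter :: "'a filter \<Rightarrow> bool" where
  "ultrafilter p \<longleftrightarrow> p \<noteq> bot \<and> (\<forall>P. eventually P p \<or> eventually (\<lambda>x. \<not> P x) p)"

text \<open>\<open>\<beta>\<omega>\<close> with the Stone topology; its basic open sets form a subbase as given here.\<close>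

definition beta_omega :: "nat filter topology" where
  "beta_omega =
     topology_generated_by (range (\<lambda>A. {p. ultrafilter p \<and> eventually (\<lambda>n. n \<in> A) p}))"

lemma topspace_beta_omega: "topspace beta_omega = {p. ultrafilter p}"
proof -
  have "\<exists>A. eventually (\<lambda>n. n \<in> A) p" for p :: "nat filter"
    by (rule exI[of _ UNIV]) simp
  then show ?thesis
    unfolding beta_omega_def topology_generated_by_topspace by auto
qed

text \<open>As usual, \<open>n \<in> \<omega>\<close> is identified with the principal ultrafilter at \<open>n\<close>.\<close>

definition omega_star :: "nat filter topology" where
  "omega_star = subtopology beta_omega (topspace beta_omega - range (\<lambda>n. principal {n}))"

definition K_set :: "nat filter \<Rightarrow> nat filter set" where
  "K_set F = {p \<in> topspace beta_omega. p \<le> F}"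

definition crowded_space :: "'a topology \<Rightarrow> bool" where
  "crowded_space X \<longleftrightarrow> \<not> (\<exists>x\<in>topspace X. openin X {x})"

definition nowhere_dense_in :: "'a topology \<Rightarrow> 'a set \<Rightarrow> bool" where
  "nowhere_dense_in X S \<longleftrightarrow> S \<subseteq> topspace X \<and> X interior_of (X closure_of S) = {}"

end

theory Submission
  imports Defs
begin

text \<open>
  \<^bold>\<open>Why there is such a filter.\<close> It suffices to find a filter \<open>F0\<close> such that for every permutation
  \<open>f\<close> of \<open>\<omega>\<close> some \<open>A \<in> F0\<close> satisfies: if \<open>a \<in> A\<close> and \<open>f a \<in> A\<close> then \<open>f a = a\<close>
  (equivalently, no permutation takes an ultrafilter in \<open>K(F0)\<close> to a different one in \<open>K(F0)\<close>). This
  condition passes to all finer filters, and it implies reversibility: if \<open>f\<close> induces a continuous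
  bijection of \<open>\<xi>(F)\<close>, then \<open>A\<close> and its preimage belong to \<open>F\<close>, so \<open>f\<close> is the identity on a member
  of \<open>F\<close> (\<open>reversible_filterI\<close>).

  Divide \<open>\<omega>\<close> into infinitely many infinite columns, let \<open>p m\<close> be a free ultrafilter on the \<open>m\<close>-th
  column, and let \<open>F0\<close> consist of the sets that belong to all but finitely many \<open>p m\<close>. Then \<open>K(F0)\<close>
  is the set of limits of the sequence \<open>p\<close> along free ultrafilters, that is, the remainder of a
  discrete sequence in its closure. So it is a copy of \<open>\<omega>*\<close>, hence crowded, and the filters
  \<open>filter_lim (Sup X) p\<close> give copies of all closed \<open>X\<close>
  (\<open>K_set_filter_lim_homeomorphic\<close>, \<open>crowded_K_set_filter_lim\<close>, \<open>nowhere_dense_K_set_filter_lim\<close>).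

  It remains to choose the \<open>p m\<close> so that \<open>F0\<close> satisfies the condition on permutations. Inside a single
  column Katetov's theorem provides the set \<open>A\<close> for every ultrafilter. For different columns it is enough
  that for every \<open>g\<close> and \<open>n\<close> the ultrafilters have members \<open>A m\<close> such that \<open>g\<close> maps no point of \<open>A n\<close>
  into \<open>A m\<close> with \<open>m > n\<close>; this is used both for a permutation and for its inverse
  (\<open>ex_set_moved_off\<close>). There are continuum many pairs \<open>(g, n)\<close>. They are treated one after
  another in a transfinite recursion in the style of Kunen, which starts in every column from an independent family
  of continuum size. Each stage enlarges the filters of all columns and uses up finitely many sets of
  the independent family in each column (\<open>separation_step\<close>, \<open>ex_separating_filters\<close>), so the family
  is never exhausted and the filters remain proper.
\<close>

section \<open>Separating filters by means of an independent family\<close>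

lemma frequently_inf_principal:
  "frequently P (inf F (principal A)) \<longleftrightarrow> frequently (\<lambda>x. x \<in> A \<and> P x) F"
  by (simp add: frequently_def eventually_inf_principal)

text \<open>
  A family is independent if none of its finite Boolean combinations, the cells, is empty;
  below, emptiness is understood modulo a filter.
\<close>

definition cell :: "('i \<Rightarrow> 'a set) \<Rightarrow> 'i set \<Rightarrow> 'i set \<Rightarrow> 'a set" where
  "cell X S T = {x. (\<forall>s\<in>S. x \<in> X s) \<and> (\<forall>t\<in>T. x \<notin> X t)}"

definition independent_mod :: "('i \<Rightarrow> 'a set) \<Rightarrow> 'i set \<Rightarrow> 'a filter \<Rightarrow> bool" where
  "independent_mod X I F \<longleftrightarrow>
     (\<forall>S T. finite S \<longrightarrow> finite T \<longrightarrow> S \<subseteq> I \<longrightarrow> T \<subseteq> I \<longrightarrow> S \<inter> T = {} \<longrightarrow>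
        (\<exists>\<^sub>F x in F. x \<in> cell X S T))"

lemma independent_modD:
  assumes "independent_mod X I F" "finite S" "finite T" "S \<subseteq> I" "T \<subseteq> I" "S \<inter> T = {}"
  shows "\<exists>\<^sub>F x in F. x \<in> cell X S T"
  using assms by (auto simp: independent_mod_def)

lemma independent_mod_antimono:
  assumes "independent_mod X I F" "J \<subseteq> I"
  shows "independent_mod X J F"
  using assms by (auto simp: independent_mod_def)

lemma independent_mod_not_bot:
  assumes "independent_mod X I F"
  shows "F \<noteq> bot"
  using independent_modD[OF assms, of "{}" "{}"] by (auto simp: frequently_def)

lemma independent_mod_cell:
  assumes "independent_mod X I F" "finite S" "finite T" "S \<subseteq> I" "T \<subseteq> I" "S \<inter> T = {}"
  shows "independent_mod X (I - (S \<union> T)) (inf F (principal (cell X S T)))"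
  unfolding independent_mod_def
proof (intro allI impI)
  fix S' T'
  assume *: "finite S'" "finite T'" "S' \<subseteq> I - (S \<union> T)" "T' \<subseteq> I - (S \<union> T)" "S' \<inter> T' = {}"
  have "\<exists>\<^sub>F x in F. x \<in> cell X (S \<union> S') (T \<union> T')"
    by (rule independent_modD[OF assms(1)]) (use assms * in auto)
  then show "\<exists>\<^sub>F x in inf F (principal (cell X S T)). x \<in> cell X S' T'"
    unfolding frequently_inf_principal
    by (rule frequently_elim1) (auto simp: cell_def)
qed

text \<open>
  Adding \<open>- Y\<close> to the filter may destroy independence, but only because some cell is contained in
  \<open>Y\<close> modulo the filter. In that case the cell is added instead, and only the finitely many
  indices that occur in it are lost. This is the device that lets an independent family decide
  arbitrary sets, and it is why the construction needs as many indices as there are tasks.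
\<close>

lemma independent_mod_decide:
  assumes ind: "independent_mod X I F"
  shows "\<exists>E r. finite r \<and> independent_mod X (I - r) (inf F (principal E)) \<and>
           (E \<inter> Y = {} \<or> E \<subseteq> Y)"
proof (cases "independent_mod X I (inf F (principal (- Y)))")
  case True
  then show ?thesis
    by (intro exI[of _ "- Y"] exI[of _ "{}"]) auto
next
  case False
  then obtain S T where ST: "finite S" "finite T" "S \<subseteq> I" "T \<subseteq> I" "S \<inter> T = {}"
    and "\<not> (\<exists>\<^sub>F x in inf F (principal (- Y)). x \<in> cell X S T)"
    by (auto simp: independent_mod_def)
  then have ev: "\<forall>\<^sub>F x in F. x \<in> cell X S T \<longrightarrow> x \<in> Y"
    by (auto simp: frequently_def eventually_inf_principal elim: eventually_mono)
  have "inf F (principal (cell X S T \<inter> Y)) = inf F (principal (cell X S T))"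
    by (rule antisym; rule filter_leI)
       (use ev in \<open>auto simp: eventually_inf_principal elim: eventually_elim2\<close>)
  with independent_mod_cell[OF ind ST] ST show ?thesis
    by (intro exI[of _ "cell X S T \<inter> Y"] exI[of _ "S \<union> T"]) auto
qed

text \<open>
  One task \<open>(g, n)\<close> of the construction. For ultrafilters it says that the \<open>g\<close>-image of \<open>G n\<close>
  is not in the closure of \<open>{G m | m > n}\<close>.
\<close>

definition separated :: "('a \<Rightarrow> 'a) \<Rightarrow> nat \<Rightarrow> (nat \<Rightarrow> 'a filter) \<Rightarrow> bool" where
  "separated g n G \<longleftrightarrow>
     (\<exists>A. (\<forall>m. \<forall>\<^sub>F x in G m. x \<in> A m) \<and> (\<forall>m>n. \<forall>a\<in>A n. g a \<notin> A m))"

lemma separated_antimono: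
  assumes "separated g n G" "\<And>m. G' m \<le> G m"
  shows "separated g n G'"
  using assms unfolding separated_def by (meson filter_leD)

text \<open>
  Choose one index \<open>i m\<close> in every column and let \<open>Y\<close> be the set of points that \<open>g\<close> maps into the
  chosen sets. The filter of column \<open>n\<close> can decide \<open>Y\<close>. If it then avoids \<open>Y\<close>, the other columns
  concentrate on the chosen sets, and if it lies inside \<open>Y\<close>, they concentrate on the complements. In
  both cases no point of column \<open>n\<close> is mapped to where the others live. Although infinitely many
  columns are treated at once, each of them loses only finitely many indices.
\<close>

lemma separation_step:
  assumes ind: "\<And>m. independent_mod X (I m) (H m)"
    and ne: "\<And>m. I m \<noteq> {}"
    and col: "\<And>m. \<forall>\<^sub>F x in H m. c x = m"
  shows "\<exists>G r. (\<forall>m. G m \<le> H m \<and> finite (r m) \<and> independent_mod X (I m - r m) (G m)) \<and>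
           separated g n G"
proof -
  have "\<forall>m. \<exists>i. i \<in> I m"
    using ne by blast
  then obtain i where i: "\<And>m. i m \<in> I m"
    by metis
  define Y where "Y = {a. g a \<in> X (i (c (g a)))}"
  obtain E r where E: "finite r" "independent_mod X (I n - r) (inf (H n) (principal E))"
    and EY: "E \<inter> Y = {} \<or> E \<subseteq> Y"
    using independent_mod_decide[OF ind] by meson
  define B where "B m = (if m = n then E else if E \<inter> Y = {} then X (i m) else - X (i m))" for m
  define G where "G m = inf (H m) (principal (B m))" for m
  (* Outside column n the added set is the cell of the single index i m, taken with either sign. *)
  have "independent_mod X (I m - (if m = n then r else {i m})) (G m)" for m
  proof -
    have "independent_mod X (I m - {i m}) (inf (H m) (principal (X (i m))))"
      using independent_mod_cell[OF ind[of m], of "{i m}" "{}"] i by (simp add: cell_def)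
    moreover have "independent_mod X (I m - {i m}) (inf (H m) (principal (- X (i m))))"
      using independent_mod_cell[OF ind[of m], of "{}" "{i m}"] i
      by (simp add: cell_def Compl_eq)
    ultimately show ?thesis
      using E by (auto simp: G_def B_def)
  qed
  moreover have "separated g n G"
    unfolding separated_def
  proof (intro exI[of _ "\<lambda>m. {x. c x = m} \<inter> B m"] conjI allI impI ballI)
    fix m
    show "\<forall>\<^sub>F x in G m. x \<in> {x. c x = m} \<inter> B m"
      unfolding G_def eventually_inf_principal using col[of m] by (auto elim: eventually_mono)
  next
    fix m a assume "n < m" "a \<in> {x. c x = n} \<inter> B n"
    then show "g a \<notin> {x. c x = m} \<inter> B m"
      using EY by (auto simp: B_def Y_def split: if_splits)
  qed
  ultimately show ?thesis
    using E(1) by (intro exI[of _ G] exI[of _ "\<lambda>m. if m = n then r else {i m}"]) (auto simp: G_def)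
qed

text \<open>
  Along the order type of the cardinal of \<open>'i\<close>, the stages before \<open>x\<close> are fewer than the indices.
  Hence stages that consume finitely many indices each never exhaust the family.
\<close>

lemma UN_finite_below_neq_UNIV:
  fixes x :: 'i and r :: "'i \<Rightarrow> 'i set"
  assumes inf: "infinite (UNIV :: 'i set)" and fin: "\<And>y. y \<in> underS (card_of (UNIV :: 'i set)) x \<Longrightarrow> finite (r y)"
  shows "(\<Union>y\<in>underS (card_of (UNIV :: 'i set)) x. r y) \<noteq> UNIV"
proof
  let ?U = "underS (card_of (UNIV :: 'i set)) x"
  assume eq: "(\<Union>y\<in>?U. r y) = UNIV"
  have less: "(card_of ?U, card_of (UNIV :: 'i set)) \<in> ordLess"
    by (rule card_of_underS[OF card_of_Card_order]) (simp add: Field_card_of)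
  show False
  proof (cases "finite ?U")
    case True
    then have "finite (\<Union>y\<in>?U. r y)"
      using fin by auto
    then show False
      using eq inf by simp
  next
    case False
    have "(card_of (r y), card_of ?U) \<in> ordLess" if "y \<in> ?U" for y
      by (rule finite_ordLess_infinite[OF card_of_Well_order card_of_Well_order])
         (simp_all add: Field_card_of fin[OF that] False)
    then have "(card_of (\<Union>y\<in>?U. r y), card_of ?U) \<in> ordLeq"
      by (intro card_of_UNION_ordLeq_infinite[OF False])
         (auto intro: ordLess_imp_ordLeq ordLeq_refl card_of_Card_order card_of_mono1)
    then show False
      unfolding eq using less by (simp add: not_ordLess_ordLeq)
  qed
qed

text \<open>
  Transfinite recursion performs the task \<open>\<Phi> x\<close> at stage \<open>x\<close>. Stage \<open>x\<close> produces filters and, for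
  each column, the finite set of indices that it consumes; it starts from the infimum of all earlier
  filters. Independence survives at limits since a member of the infimum of a chain of filters
  already belongs to one of them.
\<close>

lemma ex_separating_filters:
  fixes X :: "'i \<Rightarrow> 'a set" and \<Phi> :: "'i \<Rightarrow> ('a \<Rightarrow> 'a) \<times> nat"
  assumes inf: "infinite (UNIV :: 'i set)"
    and ind: "\<And>m. independent_mod X UNIV (H m)"
    and col: "\<And>m. \<forall>\<^sub>F x in H m. c x = m"
  shows "\<exists>G. (\<forall>m. G m \<le> H m \<and> G m \<noteq> bot) \<and> (\<forall>i. separated (fst (\<Phi> i)) (snd (\<Phi> i)) G)"
proof -
  define W where "W = card_of (UNIV :: 'i set)"
  have wo: "Well_order W" and field: "Field W = UNIV"
    unfolding W_def by (rule card_of_Well_order, rule Field_card_of)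
  then have wf: "wf (W - Id)" and lin: "Linear_order W"
    by (simp_all add: well_order_on_def)
  then have trans: "trans W" and antisym: "antisym W"
    by (simp_all add: order_on_defs)
  have below: "(y, x) \<in> W - Id \<longleftrightarrow> y \<in> underS W x" for x y
    by (auto simp: underS_def)
  define before where
    "before f x m = inf (H m) (INF y\<in>underS W x. fst (f y) m)"
    for f :: "'i \<Rightarrow> (nat \<Rightarrow> 'a filter) \<times> (nat \<Rightarrow> 'i set)" and x m
  define free where "free f x m = - (\<Union>y\<in>underS W x. snd (f y) m)"
    for f :: "'i \<Rightarrow> (nat \<Rightarrow> 'a filter) \<times> (nat \<Rightarrow> 'i set)" and x m
  define P where "P f x gr \<longleftrightarrow>
      (\<forall>m. fst gr m \<le> before f x m \<and> finite (snd gr m) \<and>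
           independent_mod X (free f x m - snd gr m) (fst gr m)) \<and>
      separated (fst (\<Phi> x)) (snd (\<Phi> x)) (fst gr)" for f x gr
  have chain: "\<exists>z\<in>U. (a = z \<or> a \<in> underS W z) \<and> (b = z \<or> b \<in> underS W z)"
    if "a \<in> U" "b \<in> U" for a b and U :: "'i set"
  proof -
    have "(a, b) \<in> W \<or> (b, a) \<in> W"
      using lin field by (metis UNIV_I linear_order_on_def refl_on_def total_on_def partial_order_on_def preorder_on_def)
    then show ?thesis
      using that by (auto simp: underS_def)
  qed
  have mono: "fst (f z) m \<le> fst (f a) m"
    if "P f z (f z)" "a = z \<or> a \<in> underS W z" for f a z m
    using that by (auto simp: P_def before_def intro: order_trans INF_lower)
  have ev_before: "eventually Q (INF y\<in>U. fst (f y) m) \<longleftrightarrow> (\<exists>y\<in>U. eventually Q (fst (f y) m))"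
    if "U \<noteq> {}" "\<And>y. y \<in> U \<Longrightarrow> P f y (f y)" for U f m Q
  proof (rule eventually_INF_base[OF that(1)])
    fix a b assume "a \<in> U" "b \<in> U"
    from chain[OF this] that(2) mono show "\<exists>x\<in>U. fst (f x) m \<le> inf (fst (f a) m) (fst (f b) m)"
      by (meson le_inf_iff)
  qed
  have ind_before: "independent_mod X (free f x m) (before f x m)"
    if IH: "\<And>y. y \<in> underS W x \<Longrightarrow> P f y (f y)" for f x m
  proof (cases "underS W x = {}")
    case True
    then show ?thesis
      using independent_mod_antimono[OF ind[of m]] by (simp add: before_def)
  next
    case False
    then obtain y0 where y0: "y0 \<in> underS W x"
      by blast
    have "fst (f y0) m \<le> H m"
      using IH[OF y0] by (auto simp: P_def before_def)
    then have "before f x m = (INF y\<in>underS W x. fst (f y) m)"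
      unfolding before_def by (meson INF_lower2 inf.absorb2 y0)
    moreover have "\<exists>\<^sub>F a in fst (f y) m. a \<in> cell X S T"
      if y: "y \<in> underS W x" and ST: "finite S" "finite T" "S \<subseteq> free f x m" "T \<subseteq> free f x m" "S \<inter> T = {}"
      for y S T
    proof (rule independent_modD)
      show "independent_mod X (free f y m - snd (f y) m) (fst (f y) m)"
        using IH[OF y] by (auto simp: P_def)
      have "underS W y \<subseteq> underS W x"
        using y trans antisym by (auto simp: underS_def dest: transD antisymD)
      with y have "free f x m \<subseteq> free f y m - snd (f y) m"
        by (auto simp: free_def)
      with ST show "S \<subseteq> free f y m - snd (f y) m" "T \<subseteq> free f y m - snd (f y) m"
        by auto
    qed fact+
    ultimately show ?thesis
      using ev_before[OF False IH] by (auto simp: independent_mod_def frequently_def)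
  qed
  obtain f where f: "\<And>x. P f x (f x)"
  proof -
    have "\<exists>f. \<forall>x. P f x (f x)"
    proof (rule dependent_wf_choice[OF wf])
      fix f g :: "'i \<Rightarrow> (nat \<Rightarrow> 'a filter) \<times> (nat \<Rightarrow> 'i set)" and x gr
      assume "\<And>z. (z, x) \<in> W - Id \<Longrightarrow> f z = g z"
      then have "\<And>z. z \<in> underS W x \<Longrightarrow> f z = g z"
        by (simp only: below)
      then have "before f x m = before g x m" "free f x m = free g x m" for m
        by (simp_all add: before_def free_def)
      then show "P f x gr = P g x gr"
        by (simp add: P_def)
    next
      fix x f
      assume "\<And>y. (y, x) \<in> W - Id \<Longrightarrow> P f y (f y)"
      then have IH: "\<And>y. y \<in> underS W x \<Longrightarrow> P f y (f y)"
        by (simp only: below)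
      have ne: "free f x m \<noteq> {}" for m
        using UN_finite_below_neq_UNIV[OF inf, of x "\<lambda>y. snd (f y) m"] IH
        by (auto simp: free_def W_def P_def)
      have "\<forall>\<^sub>F a in before f x m. c a = m" for m
        using col[of m] by (auto simp: before_def intro: filter_leD[OF inf.cobounded1])
      from separation_step[OF ind_before[OF IH] ne this, of "fst (\<Phi> x)" "snd (\<Phi> x)"]
      obtain G r where "(\<forall>m. G m \<le> before f x m \<and> finite (r m) \<and> independent_mod X (free f x m - r m) (G m)) \<and>
           separated (fst (\<Phi> x)) (snd (\<Phi> x)) G"
        by blast
      then show "\<exists>gr. P f x gr"
        by (intro exI[of _ "(G, r)"]) (simp add: P_def)
    qed
    then show ?thesis
      using that by blast
  qed
  define G where "G m = (INF y. fst (f y) m)" for m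
  have G_le: "G m \<le> fst (f y) m" for m y
    unfolding G_def by (rule INF_lower) simp
  have "G m \<le> H m" for m
    using G_le[of m undefined] f[of undefined] by (auto simp: P_def before_def intro: order_trans)
  moreover have "G m \<noteq> bot" for m
  proof
    assume "G m = bot"
    then obtain y where "fst (f y) m = bot"
      using ev_before[of UNIV f "\<lambda>_. False" m] f by (auto simp: G_def trivial_limit_def)
    moreover have "fst (f y) m \<noteq> bot"
      using f[of y] independent_mod_not_bot by (auto simp: P_def)
    ultimately show False
      by blast
  qed
  moreover have "separated (fst (\<Phi> i)) (snd (\<Phi> i)) G" for i
    using f[of i] G_le by (auto simp: P_def intro: separated_antimono)
  ultimately show ?thesis
    by blast
qed

section \<open>Ultrafilters and limits along a filter\<close>

lemma ex_ultrafilter_le: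
  fixes F :: "'a filter"
  assumes "F \<noteq> bot"
  shows "\<exists>p\<le>F. ultrafilter p"
proof -
  define S where "S = {G. G \<le> F \<and> G \<noteq> bot}"
  have "\<exists>m\<in>S. \<forall>a\<in>S. a \<le> m \<longrightarrow> a = m"
  proof (rule predicate_Zorn)
    show "partial_order_on S (relation_of (\<lambda>x y. y \<le> x) S)"
      by (rule partial_order_on_relation_ofI) auto
  next
    fix C assume C: "C \<in> Chains (relation_of (\<lambda>x y. y \<le> x) S)"
    show "\<exists>u\<in>S. \<forall>a\<in>C. u \<le> a"
    proof (cases "C = {}")
      case True
      then show ?thesis
        using assms by (auto simp: S_def)
    next
      case False
      have CS: "C \<subseteq> S"
        using C by (auto simp: Chains_def relation_of_def)
      have "\<exists>z\<in>C. z \<le> inf x y" if "x \<in> C" "y \<in> C" for x y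
        using C that by (auto simp: Chains_def relation_of_def)
      then have "eventually (\<lambda>_. False) (Inf C) \<longleftrightarrow> (\<exists>b\<in>C. eventually (\<lambda>_. False) b)"
        by (rule eventually_Inf_base[OF False])
      then have "Inf C \<noteq> bot"
        using CS by (auto simp: trivial_limit_def S_def)
      moreover have "Inf C \<le> F"
        using False CS by (auto simp: S_def intro: Inf_lower2)
      ultimately show ?thesis
        by (auto simp: S_def intro: Inf_lower)
    qed
  qed
  then obtain p where p: "p \<le> F" "p \<noteq> bot" and max: "\<And>a. a \<le> p \<Longrightarrow> a \<noteq> bot \<Longrightarrow> a = p"
    by (force simp: S_def)
  have "ultrafilter p"
    unfolding ultrafilter_def
  proof (intro conjI allI)
    fix P
    show "eventually P p \<or> eventually (\<lambda>x. \<not> P x) p"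
    proof (cases "inf p (principal {x. P x}) = bot")
      case True
      then show ?thesis
        by (auto simp: trivial_limit_def eventually_inf_principal)
    next
      case False
      then have "p \<le> principal {x. P x}"
        using max[of "inf p (principal {x. P x})"] by (metis inf.cobounded1 inf.cobounded2)
      then show ?thesis
        by (simp add: le_principal)
    qed
  qed fact
  with p show ?thesis
    by blast
qed

lemma ultrafilter_not_bot: "ultrafilter p \<Longrightarrow> p \<noteq> bot"
  by (simp add: ultrafilter_def)

lemma eventually_not_ultrafilter:
  assumes "ultrafilter p"
  shows "eventually (\<lambda>x. \<not> P x) p \<longleftrightarrow> \<not> eventually P p"
proof -
  have "\<not> (eventually P p \<and> eventually (\<lambda>x. \<not> P x) p)"
    using ultrafilter_not_bot[OF assms] eventually_conj[of P p "\<lambda>x. \<not> P x"]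
    by (auto simp: trivial_limit_def)
  with assms show ?thesis
    by (auto simp: ultrafilter_def)
qed

lemma ultrafilter_eqI:
  assumes "ultrafilter p" "ultrafilter q" "q \<le> p"
  shows "q = p"
proof (rule antisym)
  show "p \<le> q"
  proof (rule filter_leI, rule ccontr)
    fix P assume "eventually P q" "\<not> eventually P p"
    then have "\<forall>\<^sub>F x in q. \<not> P x"
      using eventually_not_ultrafilter[OF assms(1)] filter_leD[OF assms(3)] by blast
    then show False
      using \<open>eventually P q\<close> eventually_not_ultrafilter[OF assms(2)] by blast
  qed
qed fact

lemma ultrafilter_filtermap: "ultrafilter p \<Longrightarrow> ultrafilter (filtermap f p)"
  by (simp add: ultrafilter_def eventually_filtermap filtermap_bot_iff)

lemma free_ultrafilter_iff:
  fixes p :: "nat filter"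
  assumes "ultrafilter p"
  shows "p \<le> cofinite \<longleftrightarrow> p \<notin> range (\<lambda>n. principal {n})"
proof
  assume le: "p \<le> cofinite"
  show "p \<notin> range (\<lambda>n. principal {n})"
  proof
    assume "p \<in> range (\<lambda>n. principal {n})"
    then obtain n where "p = principal {n}"
      by auto
    moreover have "\<forall>\<^sub>F x in cofinite. x \<noteq> n"
      by (simp add: eventually_cofinite)
    ultimately show False
      using filter_leD[OF le, of "\<lambda>x. x \<noteq> n"] by (simp add: eventually_principal)
  qed
next
  assume nonprincipal: "p \<notin> range (\<lambda>n. principal {n})"
  have "\<forall>\<^sub>F x in p. x \<noteq> n" for n
  proof (rule ccontr)
    assume "\<not> (\<forall>\<^sub>F x in p. x \<noteq> n)"
    then have "\<forall>\<^sub>F x in p. x = n"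
      using eventually_not_ultrafilter[OF assms, of "\<lambda>x. x = n"] by simp
    then have "p \<le> principal {n}"
      by (simp add: le_principal)
    moreover have "ultrafilter (principal {n})"
      by (auto simp: ultrafilter_def eventually_principal principal_eq_bot_iff)
    ultimately show False
      using ultrafilter_eqI[OF _ assms] nonprincipal by blast
  qed
  then have fin: "\<forall>\<^sub>F x in p. \<forall>n\<in>N. x \<noteq> n" if "finite N" for N
    using that by (simp add: eventually_ball_finite_distrib)
  show "p \<le> cofinite"
  proof (rule filter_leI)
    fix P assume "eventually P (cofinite :: nat filter)"
    then have "finite {x. \<not> P x}"
      by (simp add: eventually_cofinite)
    from fin[OF this] show "eventually P p"
      by (rule eventually_mono) auto
  qed
qed

text \<open>
  For ultrafilters this is the limit of \<open>p\<close> along \<open>q\<close> in the compact space of ultrafilters, usually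
  written \<open>q\<close>-\<open>lim p\<close>.
\<close>

definition filter_lim :: "'i filter \<Rightarrow> ('i \<Rightarrow> 'a filter) \<Rightarrow> 'a filter" where
  "filter_lim q p = Abs_filter (\<lambda>P. \<forall>\<^sub>F m in q. eventually P (p m))"

lemma eventually_filter_lim: "eventually P (filter_lim q p) \<longleftrightarrow> (\<forall>\<^sub>F m in q. eventually P (p m))"
  unfolding filter_lim_def
proof (rule eventually_Abs_filter, rule is_filter.intro)
  show "\<forall>\<^sub>F m in q. eventually Q (p m)"
    if "\<forall>x. P x \<longrightarrow> Q x" "\<forall>\<^sub>F m in q. eventually P (p m)" for P Q
    using that(2) by (rule eventually_mono) (use that(1) in \<open>auto elim: eventually_mono\<close>)
qed (simp_all add: eventually_conj_iff)

lemma filter_lim_mono: "q \<le> q' \<Longrightarrow> filter_lim q p \<le> filter_lim q' p"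
  by (auto intro!: filter_leI simp: eventually_filter_lim dest: filter_leD)

lemma ultrafilter_filter_lim:
  assumes "ultrafilter q" "\<And>m. ultrafilter (p m)"
  shows "ultrafilter (filter_lim q p)"
proof -
  have "filter_lim q p \<noteq> bot"
    using ultrafilter_not_bot[OF assms(1)] ultrafilter_not_bot[OF assms(2)]
    by (simp add: trivial_limit_def eventually_filter_lim)
  moreover have "eventually P (filter_lim q p) \<or> eventually (\<lambda>x. \<not> P x) (filter_lim q p)" for P
    using assms(1) unfolding eventually_filter_lim eventually_not_ultrafilter[OF assms(2)]
    by (simp add: ultrafilter_def)
  ultimately show ?thesis
    by (simp add: ultrafilter_def)
qed

text \<open>
  Since \<open>p m\<close> lives on the \<open>m\<close>-th column, the map \<open>c\<close> recovers \<open>q\<close> from the limit along \<open>q\<close>.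
  Together with the next lemma this makes \<open>q \<mapsto> filter_lim q p\<close> a bijection from the
  ultrafilters on the set of columns onto the closure of the discrete sequence \<open>p\<close>.
\<close>

lemma filtermap_filter_lim:
  assumes "\<And>m. \<forall>\<^sub>F x in p m. c x = m" "\<And>m. p m \<noteq> bot"
  shows "filtermap c (filter_lim q p) = q"
proof -
  have "(\<forall>\<^sub>F x in p m. Q (c x)) \<longleftrightarrow> Q m" for Q m
    using eventually_cong[OF assms(1)[of m], of "\<lambda>x. Q (c x)" "\<lambda>_. Q m"] assms(2) by simp
  then show ?thesis
    by (simp add: filter_eq_iff eventually_filtermap eventually_filter_lim)
qed

text \<open>
  Let \<open>P\<close> be a member of the limit along the image of \<open>u\<close>, so that \<open>u\<close> contains the union of
  the columns \<open>m\<close> with \<open>P \<in> p m\<close>. The union of \<open>P\<close> with all other columns belongs to every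
  \<open>p m\<close>, hence to \<open>u\<close>, and therefore \<open>P\<close> belongs to \<open>u\<close>.
\<close>

lemma ultrafilter_eq_filter_lim:
  assumes col: "\<And>m. \<forall>\<^sub>F x in p m. c x = m"
    and p: "\<And>m. ultrafilter (p m)"
    and u: "ultrafilter u" "u \<le> filter_lim F p"
  shows "u = filter_lim (filtermap c u) p"
proof (rule ultrafilter_eqI)
  show "u \<le> filter_lim (filtermap c u) p"
  proof (rule filter_leI)
    fix P assume "eventually P (filter_lim (filtermap c u) p)"
    then have "\<forall>\<^sub>F x in u. eventually P (p (c x))"
      by (simp add: eventually_filter_lim eventually_filtermap)
    moreover have "\<forall>\<^sub>F x in p m. eventually P (p (c x)) \<longrightarrow> P x" for m
    proof (cases "eventually P (p m)")
      case True
      then show ?thesis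
        by (rule eventually_mono) simp
    next
      case False
      from col[of m] show ?thesis
        by (rule eventually_mono) (use False in auto)
    qed
    then have "\<forall>\<^sub>F x in u. eventually P (p (c x)) \<longrightarrow> P x"
      by (intro filter_leD[OF u(2)]) (simp add: eventually_filter_lim)
    ultimately show "eventually P u"
      by (rule eventually_rev_mp)
  qed
qed (intro ultrafilter_filter_lim ultrafilter_filtermap p u(1))+

section \<open>A sequence of ultrafilters that no map entangles\<close>

text \<open>
  Natural numbers code triples \<open>(c, k, L)\<close>. The first component is the column; the other two make
  room in every column for the independent family defined next.
\<close>

definition column_of :: "nat \<Rightarrow> nat" where
  "column_of n = fst (from_nat n :: nat \<times> nat \<times> nat list list)"

text \<open>
  The classical independent family of continuum size, in a form indexed by the branches of the tree
  of finite sequences: \<open>L\<close> lists the initial segments of length \<open>k\<close> that are accepted, and finitely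
  many distinct branches have distinct initial segments once \<open>k\<close> is large.
\<close>

definition branch_set :: "(nat \<Rightarrow> nat) \<Rightarrow> nat set" where
  "branch_set s =
     {n. case (from_nat n :: nat \<times> nat \<times> nat list list) of (_, k, L) \<Rightarrow> map s [0..<k] \<in> set L}"

lemma independent_branch_sets:
  "independent_mod branch_set UNIV (inf cofinite (principal {n. column_of n = m}))"
  unfolding independent_mod_def frequently_inf_principal
proof (intro allI impI)
  fix S T :: "(nat \<Rightarrow> nat) set"
  assume fin: "finite S" "finite T" and disj: "S \<inter> T = {}"
  have "\<forall>\<^sub>F k in sequentially. map s [0..<k] \<noteq> map t [0..<k]" if "s \<in> S" "t \<in> T" for s t
  proof -
    have "s \<noteq> t"
      using that disj by blast
    then obtain j where "s j \<noteq> t j"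
      by blast
    then have "map s [0..<k] \<noteq> map t [0..<k]" if "j < k" for k
      using that by (auto simp: map_eq_conv)
    then show ?thesis
      by (auto simp: eventually_at_top_dense)
  qed
  then have "\<forall>\<^sub>F k in sequentially. \<forall>s\<in>S. \<forall>t\<in>T. map s [0..<k] \<noteq> map t [0..<k]"
    using fin by (simp add: eventually_ball_finite_distrib)
  then obtain k0 where k0: "\<And>k s t. k0 \<le> k \<Longrightarrow> s \<in> S \<Longrightarrow> t \<in> T \<Longrightarrow> map s [0..<k] \<noteq> map t [0..<k]"
    unfolding eventually_sequentially by blast
  obtain xs where xs: "set xs = S"
    using fin(1) finite_list by blast
  define h where "h k = (to_nat (m, k, map (\<lambda>s. map s [0..<k]) xs))" for k
  have "inj h"
    by (rule injI) (simp add: h_def)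
  then have "infinite (h ` {k0..})"
    by (metis finite_imageD infinite_Ici inj_on_subset subset_UNIV)
  moreover have "h ` {k0..} \<subseteq> {n. n \<in> {n. column_of n = m} \<and> n \<in> cell branch_set S T}"
  proof
    fix n assume "n \<in> h ` {k0..}"
    then obtain k where k: "k0 \<le> k" "n = h k"
      by auto
    have "map t [0..<k] \<notin> (\<lambda>s. map s [0..<k]) ` S" if "t \<in> T" for t
    proof
      assume "map t [0..<k] \<in> (\<lambda>s. map s [0..<k]) ` S"
      then obtain s where "s \<in> S" "map t [0..<k] = map s [0..<k]"
        by (rule imageE)
      with k0[OF k(1) _ that] show False
        by metis
    qed
    with k(1) show "n \<in> {n. n \<in> {n. column_of n = m} \<and> n \<in> cell branch_set S T}"
      by (simp add: k(2) h_def column_of_def branch_set_def cell_def xs, blast)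
  qed
  ultimately show "\<exists>\<^sub>F n in cofinite. n \<in> {n. column_of n = m} \<and> n \<in> cell branch_set S T"
    unfolding frequently_cofinite using finite_subset by blast
qed

text \<open>
  The tasks \<open>(g, n)\<close> are coded by the same functions that index the independent family, so there are
  exactly as many stages as indices.
\<close>

lemma ex_separated_ultrafilters:
  "\<exists>p. (\<forall>m. ultrafilter (p m) \<and> p m \<le> cofinite \<and> (\<forall>\<^sub>F x in p m. column_of x = m)) \<and>
       (\<forall>g n. separated g n p)"
proof -
  define H where "H m = inf cofinite (principal {n. column_of n = m})" for m
  define \<Phi> :: "(nat \<Rightarrow> nat) \<Rightarrow> (nat \<Rightarrow> nat) \<times> nat" where "\<Phi> i = (\<lambda>k. i (Suc k), i 0)" for i
  have "infinite (UNIV :: (nat \<Rightarrow> nat) set)"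
    by (metis finite_fun_UNIVD2 infinite_UNIV_nat)
  moreover have "independent_mod branch_set UNIV (H m)" for m
    unfolding H_def by (rule independent_branch_sets)
  moreover have H: "\<forall>\<^sub>F x in H m. column_of x = m" "H m \<le> cofinite" for m
    by (simp_all add: H_def eventually_inf_principal)
  ultimately obtain G where G: "\<And>m. G m \<le> H m" "\<And>m. G m \<noteq> bot"
    and sep: "\<And>i. separated (fst (\<Phi> i)) (snd (\<Phi> i)) G"
    using ex_separating_filters[of branch_set H column_of \<Phi>] by blast
  have "\<forall>m. \<exists>p\<le>G m. ultrafilter p"
    using ex_ultrafilter_le G(2) by blast
  then obtain p where p: "\<And>m. p m \<le> G m" "\<And>m. ultrafilter (p m)"
    by metis
  have "separated g n p" for g n
    using separated_antimono[OF sep[of "case_nat n g"] p(1)] by (simp add: \<Phi>_def)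
  moreover have "p m \<le> H m" for m
    using p(1) G(1) by (rule order_trans)
  then have "p m \<le> cofinite" "\<forall>\<^sub>F x in p m. column_of x = m" for m
    using H by (blast intro: order_trans filter_leD)+
  ultimately show ?thesis
    using p(2) by blast
qed

text \<open>
  The members obtained for the different \<open>n\<close> can be merged because only the tasks with \<open>n \<le> m\<close>
  concern column \<open>m\<close>, and a filter is closed under finite intersections. This is why a task only
  refers to later columns.
\<close>

lemma separated_simultaneously:
  assumes "\<And>n. separated g n p"
  shows "\<exists>B. (\<forall>m. \<forall>\<^sub>F x in p m. x \<in> B m) \<and> (\<forall>n m. n < m \<longrightarrow> (\<forall>a\<in>B n. g a \<notin> B m))"
proof -
  have "\<forall>n. \<exists>A. (\<forall>m. \<forall>\<^sub>F x in p m. x \<in> A m) \<and> (\<forall>m>n. \<forall>a\<in>A n. g a \<notin> A m)"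
    using assms by (simp add: separated_def)
  then obtain A where A: "\<And>n m. \<forall>\<^sub>F x in p m. x \<in> A n m"
    and sep: "\<And>n m a. n < m \<Longrightarrow> a \<in> A n n \<Longrightarrow> g a \<notin> A n m"
    by metis
  define B where "B m = (\<Inter>n\<in>{..m}. A n m)" for m
  have "\<forall>\<^sub>F x in p m. x \<in> B m" for m
    unfolding B_def using A[of _ m] by (simp add: eventually_ball_finite_distrib)
  moreover have "g a \<notin> B m" if "n < m" "a \<in> B n" for n m a
    using sep[OF that(1), of a] that by (auto simp: B_def)
  ultimately show ?thesis
    by blast
qed

text \<open>
  The parity of the number of steps for which the orbit of a point under \<open>g\<close> keeps decreasing.
  It changes along every decreasing step, so it is a proper \<open>2\<close>-colouring of the graph of \<open>g\<close>
  restricted to its points of descent.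
\<close>

function descent_parity :: "(nat \<Rightarrow> nat) \<Rightarrow> nat \<Rightarrow> bool" where
  "descent_parity g n = (if g n < n then \<not> descent_parity g (g n) else True)"
  by pat_completeness auto
termination
  by (relation "Wellfounded.measure snd") auto

declare descent_parity.simps [simp del]

text \<open>
  An instance of Katetov's theorem that a map without fixed points moves some member of each
  ultrafilter off itself. The ultrafilter decides whether \<open>f\<close> fixes, decreases or increases its
  points; in the last two cases \<open>f\<close> alternates the descent parity of \<open>f\<close>, respectively of its
  inverse, and the ultrafilter picks one colour.
\<close>

lemma ex_set_fixed_or_moved_off:
  fixes p :: "nat filter"
  assumes p: "ultrafilter p" and f: "inj f"
  shows "\<exists>D. (\<forall>\<^sub>F x in p. x \<in> D) \<and> (\<forall>a\<in>D. f a \<in> D \<longrightarrow> f a = a)"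
proof -
  have two_coloured: ?thesis
    if R: "eventually R p" and hue: "\<And>a. R a \<Longrightarrow> hue (f a) = (\<not> hue a)" for R hue
  proof -
    have "eventually hue p \<or> (\<forall>\<^sub>F x in p. \<not> hue x)"
      using p by (simp add: ultrafilter_def)
    then obtain b where "\<forall>\<^sub>F x in p. hue x = b"
    proof
      assume "eventually hue p"
      then show ?thesis
        by (intro that[of True]) simp
    next
      assume "\<forall>\<^sub>F x in p. \<not> hue x"
      then show ?thesis
        by (intro that[of False]) simp
    qed
    with R have "\<forall>\<^sub>F x in p. x \<in> {x. R x \<and> hue x = b}"
      by eventually_elim simp
    then show ?thesis
      using hue by (intro exI[of _ "{x. R x \<and> hue x = b}"]) auto
  qed
  consider "\<forall>\<^sub>F x in p. f x = x" | "\<forall>\<^sub>F x in p. f x < x" | "\<forall>\<^sub>F x in p. x < f x"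
  proof -
    have "(\<forall>\<^sub>F x in p. x < f x)"
      if "\<forall>\<^sub>F x in p. f x \<noteq> x" "\<forall>\<^sub>F x in p. \<not> f x < x"
      using that by eventually_elim auto
    then show ?thesis
      using p that unfolding ultrafilter_def by blast
  qed
  then show ?thesis
  proof cases
    case 1
    then show ?thesis
      by (intro exI[of _ "{x. f x = x}"]) auto
  next
    case 2
    then show ?thesis
      by (rule two_coloured[of _ "descent_parity f"]) (subst (2) descent_parity.simps, simp)
  next
    case 3
    then show ?thesis
      by (rule two_coloured[of _ "descent_parity (inv f)"])
         (subst descent_parity.simps, simp add: inv_f_f[OF f])
  qed
qed

text \<open>
  Points of \<open>A\<close> that \<open>f\<close> maps to a later column are excluded by the separation for \<open>f\<close>, those
  mapped to an earlier column by the separation for the inverse of \<open>f\<close>, and those that move within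
  their column by Katetov's theorem.
\<close>

lemma ex_set_moved_off:
  assumes p: "\<And>m. ultrafilter (p m)" and col: "\<And>m. \<forall>\<^sub>F x in p m. column_of x = m"
    and sep: "\<And>g n. separated g n p" and f: "bij f"
  shows "\<exists>A. (\<forall>m. \<forall>\<^sub>F x in p m. x \<in> A) \<and> (\<forall>a\<in>A. f a \<in> A \<longrightarrow> f a = a)"
proof -
  have f_inv: "inv f (f a) = a" for a
    using f by (simp add: bij_is_inj inv_f_f)
  obtain B where B: "\<And>m. \<forall>\<^sub>F x in p m. x \<in> B m" "\<And>n m a. n < m \<Longrightarrow> a \<in> B n \<Longrightarrow> f a \<notin> B m"
    using separated_simultaneously[OF sep, of f] by metis
  obtain C where C: "\<And>m. \<forall>\<^sub>F x in p m. x \<in> C m" "\<And>n m a. n < m \<Longrightarrow> a \<in> C n \<Longrightarrow> inv f a \<notin> C m"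
    using separated_simultaneously[OF sep, of "inv f"] by metis
  have "\<forall>m. \<exists>D. (\<forall>\<^sub>F x in p m. x \<in> D) \<and> (\<forall>a\<in>D. f a \<in> D \<longrightarrow> f a = a)"
    using ex_set_fixed_or_moved_off[OF p bij_is_inj[OF f]] by blast
  then obtain D where D: "\<And>m. \<forall>\<^sub>F x in p m. x \<in> D m" "\<And>m a. a \<in> D m \<Longrightarrow> f a \<in> D m \<Longrightarrow> f a = a"
    by metis
  define A where "A = {x. x \<in> B (column_of x) \<inter> C (column_of x) \<inter> D (column_of x)}"
  have "\<forall>\<^sub>F x in p m. x \<in> A" for m
    using B(1)[of m] C(1)[of m] D(1)[of m] col[of m] by eventually_elim (simp add: A_def)
  moreover have "f a = a" if "a \<in> A" "f a \<in> A" for a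
  proof (cases "column_of a" "column_of (f a)" rule: linorder_cases)
    case less
    then show ?thesis
      using B(2)[of "column_of a" "column_of (f a)" a] that by (simp add: A_def)
  next
    case equal
    have "a \<in> D (column_of a)" "f a \<in> D (column_of (f a))"
      using that by (simp_all add: A_def)
    with D(2) show ?thesis
      by (metis equal)
  next
    case greater
    then show ?thesis
      using C(2)[of "column_of (f a)" "column_of a" "f a"] that by (simp add: A_def f_inv)
  qed
  ultimately show ?thesis
    by blast
qed

section \<open>Reversibility\<close>

text \<open>
  If \<open>F\<close> is proper, a continuous bijection of \<open>\<xi>(F)\<close> comes from a permutation \<open>f\<close> of \<open>\<omega>\<close>, and
  continuity says that preimages of members of \<open>F\<close> are members. So \<open>A\<close> and its preimage are members,
  and on their intersection \<open>f\<close> is the identity. Hence \<open>f\<close> preserves \<open>F\<close>. The condition is inherited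
  by all finer filters.
\<close>

lemma reversible_filterI:
  assumes move: "\<And>f. bij f \<Longrightarrow> \<exists>A. (\<forall>\<^sub>F x in F. x \<in> A) \<and> (\<forall>a\<in>A. f a \<in> A \<longrightarrow> f a = a)"
  shows "reversible_filter F"
  unfolding reversible_filter_def reversible_space_def
proof (intro allI impI)
  fix h assume "continuous_map (xi F) (xi F) h \<and> bij_betw h (topspace (xi F)) (topspace (xi F))"
  then have cont: "continuous_map (xi F) (xi F) h" and bij: "bij h"
    by simp_all
  have pre: "openin (xi F) (h -` U)" if "openin (xi F) U" for U
    using openin_continuous_map_preimage[OF cont that] by (simp add: vimage_def)
  have "open_map (xi F) (xi F) h"
  proof (cases "F = bot")
    case True
    then show ?thesis
      by (simp add: open_map_def openin_xi)
  next
    case False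
    (* Otherwise the preimage of an isolated point would make the point None isolated. *)
    have hN: "h None = None"
    proof (rule ccontr)
      assume "h None \<noteq> None"
      then have "openin (xi F) (h -` {h None})"
        by (intro pre) (auto simp: openin_xi)
      moreover have "h -` {h None} = {None}"
        using bij by (auto simp: bij_def dest: injD)
      ultimately show False
        using False by (simp add: openin_xi)
    qed
    define f where "f n = the (h (Some n))" for n
    have f: "h (Some n) = Some (f n)" for n
    proof -
      have "h (Some n) \<noteq> h None"
        using bij_is_inj[OF bij] by (auto dest: injD)
      then show ?thesis
        by (auto simp: hN f_def)
    qed
    have "bij f"
    proof (rule bijI)
      show "inj f"
      proof (rule injI)
        fix x y assume "f x = f y"
        then have "h (Some x) = h (Some y)"
          by (simp add: f)
        then show "x = y"
          using bij_is_inj[OF bij] by (auto dest: injD)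
      qed
      show "surj f"
        unfolding surj_def
      proof
        fix y
        obtain x where x: "Some y = h x"
          using bij_is_surj[OF bij] by (metis surjD)
        with hN f show "\<exists>x. y = f x"
          by (cases x) auto
      qed
    qed
    then obtain A where A: "\<forall>\<^sub>F x in F. x \<in> A" "\<And>a. a \<in> A \<Longrightarrow> f a \<in> A \<Longrightarrow> f a = a"
      using move by blast
    have "openin (xi F) (h -` insert None (Some ` A))"
      using A(1) by (intro pre) (auto simp: openin_xi image_iff)
    then have "\<forall>\<^sub>F x in F. f x \<in> A"
      by (simp add: openin_xi hN f image_iff)
    with A(1) have fixed: "\<forall>\<^sub>F x in F. f x = x"
      by eventually_elim (rule A(2))
    show ?thesis
      unfolding open_map_def
    proof (intro allI impI)
      fix U assume U: "openin (xi F) U"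
      show "openin (xi F) (h ` U)"
        unfolding openin_xi
      proof
        assume "None \<in> h ` U"
        then have "None \<in> U"
          using bij_is_inj[OF bij] hN by (metis image_iff injD)
        then have "\<forall>\<^sub>F x in F. Some x \<in> U"
          using U by (simp add: openin_xi)
        with fixed show "\<forall>\<^sub>F x in F. Some x \<in> h ` U"
          by eventually_elim (metis f imageI)
      qed
    qed
  qed
  then show "homeomorphic_map (xi F) (xi F) h"
    using cont bij by (intro bijective_open_imp_homeomorphic_map) (simp_all add: bij_is_inj bij_is_surj)
qed

section \<open>The topology of the closed sets of ultrafilters\<close>

lemma openin_beta_omega_basic: "openin beta_omega {p. ultrafilter p \<and> (\<forall>\<^sub>F n in p. n \<in> A)}"
  unfolding beta_omega_def openin_topology_generated_by_iff
  by (intro generate_topology_on.Basis) auto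

lemma openin_beta_omega:
  "openin beta_omega U \<longleftrightarrow>
     (\<forall>p\<in>U. ultrafilter p \<and>
        (\<exists>A. (\<forall>\<^sub>F x in p. x \<in> A) \<and> (\<forall>q. ultrafilter q \<longrightarrow> (\<forall>\<^sub>F x in q. x \<in> A) \<longrightarrow> q \<in> U)))"
    (is "_ \<longleftrightarrow> ?N U")
proof
  assume "openin beta_omega U"
  then have "generate_topology_on
      (range (\<lambda>A. {p. ultrafilter p \<and> (\<forall>\<^sub>F n in p. n \<in> A)})) U"
    by (simp add: beta_omega_def openin_topology_generated_by_iff)
  then show "?N U"
  proof induction
    case (Int a b)
    show ?case
    proof
      fix p assume p: "p \<in> a \<inter> b"
      obtain A where A: "\<forall>\<^sub>F x in p. x \<in> A" "\<And>q. ultrafilter q \<Longrightarrow> \<forall>\<^sub>F x in q. x \<in> A \<Longrightarrow> q \<in> a"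
        using Int.IH(1) p by blast
      obtain B where B: "\<forall>\<^sub>F x in p. x \<in> B" "\<And>q. ultrafilter q \<Longrightarrow> \<forall>\<^sub>F x in q. x \<in> B \<Longrightarrow> q \<in> b"
        using Int.IH(2) p by blast
      show "ultrafilter p \<and> (\<exists>A. (\<forall>\<^sub>F x in p. x \<in> A) \<and>
              (\<forall>q. ultrafilter q \<longrightarrow> (\<forall>\<^sub>F x in q. x \<in> A) \<longrightarrow> q \<in> a \<inter> b))"
        using Int.IH(1) p A B by (intro conjI exI[of _ "A \<inter> B"]) (auto simp: eventually_conj_iff)
    qed
  next
    case (UN K)
    then show ?case
      by (meson UnionE UnionI)
  qed auto
next
  assume N: "?N U"
  show "openin beta_omega U"
    unfolding openin_subopen[of beta_omega U]
  proof
    fix p assume "p \<in> U"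
    with N obtain A where "ultrafilter p" "\<forall>\<^sub>F x in p. x \<in> A"
      and "{q. ultrafilter q \<and> (\<forall>\<^sub>F x in q. x \<in> A)} \<subseteq> U"
      by blast
    then show "\<exists>T. openin beta_omega T \<and> p \<in> T \<and> T \<subseteq> U"
      by (intro exI[of _ "{q. ultrafilter q \<and> (\<forall>\<^sub>F x in q. x \<in> A)}"])
         (simp add: openin_beta_omega_basic)
  qed
qed

lemma continuous_map_beta_omega:
  assumes "\<And>p. p \<in> topspace X \<Longrightarrow> ultrafilter (f p)"
    and "\<And>A. openin X {p \<in> topspace X. \<forall>\<^sub>F n in f p. n \<in> A}"
  shows "continuous_map X beta_omega f"
  unfolding beta_omega_def
proof (rule continuous_on_generated_topo)
  fix U :: "nat filter set" assume "U \<in> range (\<lambda>A. {p. ultrafilter p \<and> (\<forall>\<^sub>F n in p. n \<in> A)})"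
  then obtain A where A: "U = {p. ultrafilter p \<and> (\<forall>\<^sub>F n in p. n \<in> A)}"
    by blast
  have "f -` U \<inter> topspace X = {p \<in> topspace X. \<forall>\<^sub>F n in f p. n \<in> A}"
    using assms(1) by (auto simp: A)
  with assms(2)[of A] show "openin X (f -` U \<inter> topspace X)"
    by simp
next
  show "f ` topspace X \<subseteq> \<Union> (range (\<lambda>A. {p. ultrafilter p \<and> (\<forall>\<^sub>F n in p. n \<in> A)}))"
    using assms(1) by (auto intro!: exI[of _ UNIV])
qed

lemma topspace_omega_star: "topspace omega_star = {p. ultrafilter p \<and> p \<le> cofinite}"
  using free_ultrafilter_iff by (auto simp: omega_star_def topspace_beta_omega)

lemma omega_star_eq: "omega_star = subtopology beta_omega {p. ultrafilter p \<and> p \<le> cofinite}"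
  using topspace_omega_star by (simp add: omega_star_def topspace_beta_omega Int_absorb1)

lemma mem_K_set: "p \<in> K_set F \<longleftrightarrow> ultrafilter p \<and> p \<le> F"
  by (simp add: K_set_def topspace_beta_omega)

lemma topspace_K_set: "topspace (subtopology beta_omega (K_set F)) = K_set F"
  by (auto simp: topspace_beta_omega mem_K_set)

text \<open>
  This is the duality between closed sets and filters: the supremum of \<open>X\<close> is the intersection of
  its ultrafilters as families of sets. An ultrafilter outside \<open>X\<close> has a member \<open>A\<close> whose basic
  neighbourhood misses \<open>X\<close>, so the complement of \<open>A\<close> belongs to all elements of \<open>X\<close>.
\<close>

lemma K_set_Sup_closedin:
  assumes X: "closedin omega_star X"
  shows "K_set (Sup X) = X"
proof
  have sub: "X \<subseteq> {p. ultrafilter p \<and> p \<le> cofinite}"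
    using closedin_subset[OF X] by (simp add: topspace_omega_star)
  then show "X \<subseteq> K_set (Sup X)"
    by (auto simp: mem_K_set Sup_upper)
  show "K_set (Sup X) \<subseteq> X"
  proof
    fix p assume "p \<in> K_set (Sup X)"
    then have p: "ultrafilter p" "p \<le> Sup X"
      by (simp_all add: mem_K_set)
    have "Sup X \<le> cofinite"
      using sub by (auto intro: Sup_least)
    with p(2) have "p \<le> cofinite"
      by (rule order_trans)
    show "p \<in> X"
    proof (rule ccontr)
      assume "p \<notin> X"
      moreover have "openin omega_star (topspace omega_star - X)"
        using X by (simp add: closedin_def)
      then obtain U where U: "openin beta_omega U"
        and eq: "topspace omega_star - X = U \<inter> {p. ultrafilter p \<and> p \<le> cofinite}"
        by (auto simp: omega_star_eq openin_subtopology)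
      ultimately have "p \<in> U"
        using p(1) \<open>p \<le> cofinite\<close> by (auto simp: topspace_omega_star)
      then obtain A where A: "\<forall>\<^sub>F x in p. x \<in> A"
        and AU: "\<And>q. ultrafilter q \<Longrightarrow> \<forall>\<^sub>F x in q. x \<in> A \<Longrightarrow> q \<in> U"
        using U unfolding openin_beta_omega by blast
      have "\<forall>\<^sub>F x in q. x \<notin> A" if "q \<in> X" for q
        using that AU eq sub eventually_not_ultrafilter[of q "\<lambda>x. x \<in> A"] by blast
      then have "\<forall>\<^sub>F x in Sup X. x \<notin> A"
        by (simp add: eventually_Sup)
      then have "\<forall>\<^sub>F x in p. x \<notin> A"
        using p(2) by (simp add: filter_leD)
      then show False
        using A p(1) eventually_not_ultrafilter by blast
    qed
  qed
qed

lemma ex_free_ultrafilter_on: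
  assumes "infinite (A :: nat set)"
  shows "\<exists>p. ultrafilter p \<and> p \<le> cofinite \<and> (\<forall>\<^sub>F x in p. x \<in> A)"
proof -
  have "inf cofinite (principal A) \<noteq> bot"
    using assms by (simp add: trivial_limit_def eventually_inf_principal eventually_cofinite)
  then obtain p where "p \<le> inf cofinite (principal A)" "ultrafilter p"
    using ex_ultrafilter_le by blast
  then show ?thesis
    by (auto simp: le_principal)
qed

lemma continuous_map_filtermap: "continuous_map beta_omega beta_omega (filtermap f)"
proof (rule continuous_map_beta_omega)
  fix A
  have "{p \<in> topspace beta_omega. \<forall>\<^sub>F n in filtermap f p. n \<in> A} =
        {p. ultrafilter p \<and> (\<forall>\<^sub>F n in p. n \<in> f -` A)}"
    by (simp add: topspace_beta_omega eventually_filtermap)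
  then show "openin beta_omega {p \<in> topspace beta_omega. \<forall>\<^sub>F n in filtermap f p. n \<in> A}"
    by (simp only: openin_beta_omega_basic)
qed (simp add: topspace_beta_omega ultrafilter_filtermap)

lemma continuous_map_filter_lim:
  assumes "\<And>m. ultrafilter (p m)"
  shows "continuous_map beta_omega beta_omega (\<lambda>q. filter_lim q p)"
proof (rule continuous_map_beta_omega)
  fix A
  have "{q \<in> topspace beta_omega. \<forall>\<^sub>F n in filter_lim q p. n \<in> A} =
        {q. ultrafilter q \<and> (\<forall>\<^sub>F m in q. m \<in> {m. \<forall>\<^sub>F n in p m. n \<in> A})}"
    by (simp add: topspace_beta_omega eventually_filter_lim)
  then show "openin beta_omega {q \<in> topspace beta_omega. \<forall>\<^sub>F n in filter_lim q p. n \<in> A}"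
    by (simp only: openin_beta_omega_basic)
qed (simp add: topspace_beta_omega ultrafilter_filter_lim assms)

text \<open>
  The closure of the discrete sequence \<open>p\<close> is a copy of \<open>\<beta>\<omega>\<close>, with \<open>q \<mapsto> filter_lim q p\<close>
  as embedding and the image under \<open>c\<close> as inverse. This copy contains a copy of each closed \<open>X\<close>.
\<close>

lemma K_set_filter_lim_homeomorphic:
  fixes p :: "nat \<Rightarrow> nat filter"
  assumes p: "\<And>m. ultrafilter (p m)" and col: "\<And>m. \<forall>\<^sub>F x in p m. c x = m"
    and X: "closedin omega_star X"
  shows "subtopology beta_omega (K_set (filter_lim (Sup X) p)) homeomorphic_space
         subtopology omega_star X"
proof -
  let ?K = "K_set (filter_lim (Sup X) p)"
  have sub: "X \<subseteq> {p. ultrafilter p \<and> p \<le> cofinite}"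
    using closedin_subset[OF X] by (simp add: topspace_omega_star)
  then have omega_X: "subtopology omega_star X = subtopology beta_omega X"
    by (simp add: omega_star_eq subtopology_subtopology Int_absorb1)
  have topX: "topspace (subtopology beta_omega X) = X"
    using sub by (auto simp: topspace_beta_omega)
  have col_lim: "filtermap c (filter_lim q p) = q" for q
    using filtermap_filter_lim[OF col ultrafilter_not_bot[OF p]] by blast
  have K_imp: "filtermap c u \<in> X" "filter_lim (filtermap c u) p = u" if "u \<in> ?K" for u
  proof -
    from that have u: "ultrafilter u" "u \<le> filter_lim (Sup X) p"
      by (simp_all add: mem_K_set)
    have "filtermap c u \<le> Sup X"
      using filtermap_mono[OF u(2), of c] by (simp add: col_lim)
    then have "filtermap c u \<in> K_set (Sup X)"
      by (simp add: mem_K_set ultrafilter_filtermap u(1))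
    then show "filtermap c u \<in> X"
      by (simp only: K_set_Sup_closedin[OF X])
    show "filter_lim (filtermap c u) p = u"
      using ultrafilter_eq_filter_lim[OF col p u] by simp
  qed
  have lim_mem: "filter_lim q p \<in> ?K" if "q \<in> X" for q
    using that sub by (auto simp: mem_K_set intro!: ultrafilter_filter_lim p filter_lim_mono Sup_upper)
  have "homeomorphic_maps (subtopology beta_omega ?K) (subtopology beta_omega X)
          (filtermap c) (\<lambda>q. filter_lim q p)"
    unfolding homeomorphic_maps_def
  proof (intro conjI ballI)
    show "continuous_map (subtopology beta_omega ?K) (subtopology beta_omega X) (filtermap c)"
      using K_imp by (intro continuous_map_into_subtopology continuous_map_from_subtopology
          continuous_map_filtermap) (simp add: topspace_K_set)
    show "continuous_map (subtopology beta_omega X) (subtopology beta_omega ?K) (\<lambda>q. filter_lim q p)"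
      using lim_mem by (intro continuous_map_into_subtopology continuous_map_from_subtopology
          continuous_map_filter_lim p) (simp add: topX)
  qed (use K_imp col_lim in \<open>simp_all add: topspace_K_set\<close>)
  then show ?thesis
    unfolding omega_X homeomorphic_space_def by blast
qed

lemma infinite_of_eventually_free:
  fixes q :: "'a filter"
  assumes "q \<le> cofinite" "q \<noteq> bot" "\<forall>\<^sub>F m in q. m \<in> M"
  shows "infinite M"
proof
  assume "finite M"
  then have "\<forall>\<^sub>F m in cofinite. m \<notin> M"
    by (simp add: eventually_cofinite)
  then have "\<forall>\<^sub>F m in q. m \<notin> M"
    using assms(1) by (simp add: filter_leD)
  with assms(3) have "\<forall>\<^sub>F m in q. False"
    by eventually_elim simp
  with assms(2) show False
    by (simp add: trivial_limit_def)
qed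

text \<open>
  The image of \<open>u\<close> under \<open>c\<close> is free and contains the set of these columns.
\<close>

lemma infinite_columns_of_limit:
  fixes p :: "nat \<Rightarrow> nat filter"
  assumes p: "\<And>m. ultrafilter (p m)" and col: "\<And>m. \<forall>\<^sub>F x in p m. c x = m"
    and u: "u \<in> K_set (filter_lim cofinite p)" and A: "\<forall>\<^sub>F x in u. x \<in> A"
  shows "infinite {m. \<forall>\<^sub>F x in p m. x \<in> A}"
proof -
  have u': "ultrafilter u" "u \<le> filter_lim cofinite p"
    using u by (simp_all add: mem_K_set)
  have "filtermap c u \<le> cofinite"
    using filtermap_mono[OF u'(2), of c] filtermap_filter_lim[OF col ultrafilter_not_bot[OF p]]
    by simp
  moreover have "filtermap c u \<noteq> bot"
    using u'(1) by (intro ultrafilter_not_bot ultrafilter_filtermap)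
  moreover have "\<forall>\<^sub>F x in filter_lim (filtermap c u) p. x \<in> A"
    using A ultrafilter_eq_filter_lim[OF col p u'] by simp
  ultimately show ?thesis
    by (intro infinite_of_eventually_free[of "filtermap c u"]) (simp_all add: eventually_filter_lim)
qed

text \<open>
  A basic neighbourhood of a point contains the limits along every free ultrafilter that
  concentrates on a certain infinite set. Splitting that set in two yields two different limits.
\<close>

lemma crowded_K_set_filter_lim:
  fixes p :: "nat \<Rightarrow> nat filter"
  assumes p: "\<And>m. ultrafilter (p m)" and col: "\<And>m. \<forall>\<^sub>F x in p m. c x = m"
  shows "crowded_space (subtopology beta_omega (K_set (filter_lim cofinite p)))"
  unfolding crowded_space_def topspace_K_set
proof
  let ?K = "K_set (filter_lim cofinite p)"
  assume "\<exists>u\<in>?K. openin (subtopology beta_omega ?K) {u}"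
  then obtain u U where u: "u \<in> ?K" and U: "openin beta_omega U" "{u} = U \<inter> ?K"
    by (auto simp: openin_subtopology)
  then obtain A where A: "\<forall>\<^sub>F x in u. x \<in> A"
    and AU: "\<And>v. ultrafilter v \<Longrightarrow> \<forall>\<^sub>F x in v. x \<in> A \<Longrightarrow> v \<in> U"
    unfolding openin_beta_omega by blast
  have uniq: "filter_lim q p = u"
    if "ultrafilter q" "q \<le> cofinite" "\<forall>\<^sub>F m in q. m \<in> {m. \<forall>\<^sub>F x in p m. x \<in> A}" for q
  proof -
    have "ultrafilter (filter_lim q p)"
      using that(1) p by (rule ultrafilter_filter_lim)
    moreover from this have "filter_lim q p \<in> U"
      by (rule AU) (use that(3) in \<open>simp add: eventually_filter_lim\<close>)
    ultimately have "filter_lim q p \<in> U \<inter> ?K"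
      using filter_lim_mono[OF that(2), of p] by (simp add: mem_K_set)
    then show ?thesis
      unfolding U(2)[symmetric] by simp
  qed
  obtain M N where MN: "M \<subseteq> {m. \<forall>\<^sub>F x in p m. x \<in> A}" "N \<subseteq> {m. \<forall>\<^sub>F x in p m. x \<in> A}"
    "infinite M" "infinite N" "M \<inter> N = {}"
    using infinite_split[OF infinite_columns_of_limit[OF p col u A]] by metis
  obtain q where q: "ultrafilter q" "q \<le> cofinite" "\<forall>\<^sub>F m in q. m \<in> M"
    using ex_free_ultrafilter_on[OF MN(3)] by blast
  obtain r where r: "ultrafilter r" "r \<le> cofinite" "\<forall>\<^sub>F m in r. m \<in> N"
    using ex_free_ultrafilter_on[OF MN(4)] by blast
  have "filter_lim q p = u"
    by (rule uniq[OF q(1,2)], rule eventually_mono[OF q(3)]) (use MN(1) in blast)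
  moreover have "filter_lim r p = u"
    by (rule uniq[OF r(1,2)], rule eventually_mono[OF r(3)]) (use MN(2) in blast)
  ultimately have "q = r"
    using filtermap_filter_lim[OF col ultrafilter_not_bot[OF p]] by metis
  with q(3) r(3) have "\<forall>\<^sub>F m in q. m \<in> M \<inter> N"
    by (simp add: eventually_conj_iff)
  then show False
    using MN(5) ultrafilter_not_bot[OF q(1)] by (simp add: trivial_limit_def)
qed

lemma closedin_K_set:
  assumes "F \<le> cofinite"
  shows "closedin omega_star (K_set F)"
  unfolding closedin_def
proof
  show "K_set F \<subseteq> topspace omega_star"
    using assms by (auto simp: mem_K_set topspace_omega_star)
  have "openin beta_omega {p. ultrafilter p \<and> \<not> p \<le> F}"
    unfolding openin_beta_omega
  proof
    fix p assume "p \<in> {p. ultrafilter p \<and> \<not> p \<le> F}"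
    then obtain P where P: "ultrafilter p" "eventually P F" "\<not> eventually P p"
      by (auto simp: le_filter_def)
    have "\<not> q \<le> F" if "ultrafilter q" "\<forall>\<^sub>F x in q. \<not> P x" for q
      using that P(2) eventually_not_ultrafilter[of q P] by (auto dest: filter_leD)
    with P show "ultrafilter p \<and> (\<exists>A. (\<forall>\<^sub>F x in p. x \<in> A) \<and>
        (\<forall>q. ultrafilter q \<longrightarrow> (\<forall>\<^sub>F x in q. x \<in> A) \<longrightarrow> q \<in> {p. ultrafilter p \<and> \<not> p \<le> F}))"
      by (intro conjI exI[of _ "{x. \<not> P x}"]) (auto simp: eventually_not_ultrafilter)
  qed
  then show "openin omega_star (topspace omega_star - K_set F)"
    unfolding omega_star_eq openin_subtopology
    by (intro exI[of _ "{p. ultrafilter p \<and> \<not> p \<le> F}"])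
       (auto simp: mem_K_set topspace_beta_omega)
qed

lemma filter_lim_le:
  assumes "\<And>m. p m \<le> F"
  shows "filter_lim q p \<le> F"
  using filter_leD[OF assms] by (intro filter_leI) (simp add: eventually_filter_lim)

text \<open>
  A basic neighbourhood of a point, given by \<open>A\<close>, meets infinitely many columns. Take one point of
  \<open>A\<close> in each of them: since the \<open>p m\<close> are free, the complement of this transversal belongs to all of
  them. So a free ultrafilter on the transversal lies in the neighbourhood but not in the closed set.
\<close>

lemma nowhere_dense_K_set_filter_lim:
  fixes p :: "nat \<Rightarrow> nat filter"
  assumes p: "\<And>m. ultrafilter (p m)" "\<And>m. p m \<le> cofinite"
    and col: "\<And>m. \<forall>\<^sub>F x in p m. c x = m"
  shows "nowhere_dense_in omega_star (K_set (filter_lim cofinite p))"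
proof -
  let ?K = "K_set (filter_lim cofinite p)"
  have closed: "closedin omega_star ?K"
    by (intro closedin_K_set filter_lim_le p(2))
  have "u \<notin> omega_star interior_of ?K" for u
  proof
    assume u: "u \<in> omega_star interior_of ?K"
    have "openin omega_star (omega_star interior_of ?K)"
      by (rule openin_interior_of)
    then obtain U where U: "openin beta_omega U"
      and eq: "omega_star interior_of ?K = U \<inter> {p. ultrafilter p \<and> p \<le> cofinite}"
      unfolding omega_star_eq openin_subtopology by blast
    have uK: "u \<in> ?K"
      using u by (rule subsetD[OF interior_of_subset])
    have "u \<in> U"
      using u eq by blast
    then obtain A where A: "\<forall>\<^sub>F x in u. x \<in> A"
      and AU: "\<And>v. ultrafilter v \<Longrightarrow> \<forall>\<^sub>F x in v. x \<in> A \<Longrightarrow> v \<in> U"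
      using U unfolding openin_beta_omega by blast
    define M where "M = {m. \<forall>\<^sub>F x in p m. x \<in> A}"
    have "infinite M"
      unfolding M_def by (rule infinite_columns_of_limit[OF p(1) col uK A])
    have "\<exists>x. x \<in> A \<and> c x = m" if "m \<in> M" for m
    proof -
      have "\<forall>\<^sub>F x in p m. x \<in> A \<and> c x = m"
        using that col[of m] by (simp add: M_def eventually_conj_iff)
      then show ?thesis
        by (rule eventually_happens'[OF ultrafilter_not_bot[OF p(1)]])
    qed
    then obtain h where h: "\<And>m. m \<in> M \<Longrightarrow> h m \<in> A" "\<And>m. m \<in> M \<Longrightarrow> c (h m) = m"
      by metis
    have "inj_on h M"
      using h(2) by (rule inj_on_inverseI)
    then have "infinite (h ` M)"
      using \<open>infinite M\<close> finite_imageD by blast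
    then obtain v where v: "ultrafilter v" "v \<le> cofinite" "\<forall>\<^sub>F x in v. x \<in> h ` M"
      using ex_free_ultrafilter_on by blast
    have "\<forall>\<^sub>F x in v. x \<in> A"
      using v(3) by (rule eventually_mono) (use h(1) in blast)
    with v have "v \<in> omega_star interior_of ?K"
      unfolding eq using AU by blast
    then have "v \<in> ?K"
      by (rule subsetD[OF interior_of_subset])
    have "\<forall>\<^sub>F x in p m. x \<notin> h ` M" for m
    proof -
      have "\<forall>\<^sub>F x in cofinite. x \<noteq> h m"
        by (simp add: eventually_cofinite)
      then have "\<forall>\<^sub>F x in p m. x \<noteq> h m"
        by (rule filter_leD[OF p(2)])
      with col[of m] show ?thesis
        by eventually_elim (use h(2) in auto)
    qed
    then have "\<forall>\<^sub>F x in filter_lim cofinite p. x \<notin> h ` M"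
      by (simp add: eventually_filter_lim)
    moreover have "v \<le> filter_lim cofinite p"
      using \<open>v \<in> ?K\<close> by (simp add: mem_K_set)
    ultimately have "\<forall>\<^sub>F x in v. x \<notin> h ` M"
      by (simp only: filter_leD)
    then show False
      using v eventually_not_ultrafilter by blast
  qed
  then show ?thesis
    using closedin_subset[OF closed] by (auto simp: nowhere_dense_in_def closure_of_closedin[OF closed])
qed

section \<open>The filter\<close>

theorem theorem3p2:
  shows "\<exists>F0. omega_filter F0 \<and>
    (\<forall>F. omega_filter F \<and> F \<le> F0 \<longrightarrow> reversible_filter F) \<and>
    (crowded_space (subtopology beta_omega (K_set F0)) \<and> nowhere_dense_in omega_star (K_set F0)) \<and>
    (\<forall>X. closedin omega_star X \<longrightarrow>
       (\<exists>F. omega_filter F \<and> F \<le> F0 \<and>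
          subtopology beta_omega (K_set F) homeomorphic_space subtopology omega_star X))"
proof -
  obtain p where p: "\<And>m. ultrafilter (p m)" "\<And>m. p m \<le> cofinite"
    and col: "\<And>m. \<forall>\<^sub>F x in p m. column_of x = m" and sep: "\<And>g n. separated g n p"
    using ex_separated_ultrafilters by metis
  show ?thesis
  proof (rule exI[of _ "filter_lim cofinite p"], intro conjI allI impI)
    show "omega_filter (filter_lim cofinite p)"
      unfolding omega_filter_def by (rule filter_lim_le[OF p(2)])
  next
    fix F assume F: "omega_filter F \<and> F \<le> filter_lim cofinite p"
    show "reversible_filter F"
    proof (rule reversible_filterI)
      fix f :: "nat \<Rightarrow> nat" assume "bij f"
      then obtain A where A: "\<And>m. \<forall>\<^sub>F x in p m. x \<in> A" "\<forall>a\<in>A. f a \<in> A \<longrightarrow> f a = a"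
        using ex_set_moved_off[OF p(1) col sep] by metis
      have "\<forall>\<^sub>F x in F. x \<in> A"
        by (rule filter_leD[OF conjunct2[OF F]]) (simp add: eventually_filter_lim A(1))
      with A(2) show "\<exists>A. (\<forall>\<^sub>F x in F. x \<in> A) \<and> (\<forall>a\<in>A. f a \<in> A \<longrightarrow> f a = a)"
        by blast
    qed
  next
    show "crowded_space (subtopology beta_omega (K_set (filter_lim cofinite p)))"
      by (rule crowded_K_set_filter_lim[OF p(1) col])
    show "nowhere_dense_in omega_star (K_set (filter_lim cofinite p))"
      by (rule nowhere_dense_K_set_filter_lim[OF p col])
  next
    fix X assume X: "closedin omega_star X"
    show "\<exists>F. omega_filter F \<and> F \<le> filter_lim cofinite p \<and>
        subtopology beta_omega (K_set F) homeomorphic_space subtopology omega_star X"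
    proof (intro exI[of _ "filter_lim (Sup X) p"] conjI)
      show "omega_filter (filter_lim (Sup X) p)"
        unfolding omega_filter_def by (rule filter_lim_le[OF p(2)])
      have "Sup X \<le> cofinite"
        using closedin_subset[OF X] by (auto simp: topspace_omega_star intro: Sup_least)
      then show "filter_lim (Sup X) p \<le> filter_lim cofinite p"
        by (rule filter_lim_mono)
    qed (rule K_set_filter_lim_homeomorphic[OF p(1) col X])
  qed
qed

end
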